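(* Let $A\subseteq B$ be a ring extension. If $B$ is a finitely generated $A$-module, then $A\subseteq B$ is integral and $$\mathrm{d}_{A}(B)\le\mu_{A}(B).$$
   Context: All rings are commutative with identity. If $b\in B$ is integral over $A$, then $\mathrm{id}_A(b)$ is the least $n\ge1$ such that $b$ satisfies a monic polynomial equation of degree $n$ with coefficients in $A$. If $A\subseteq B$ is integral, $\mathrm{d}_A(B)=\sup\{\mathrm{id}_A(b)\mid b\in B\}$. $\mu_A(\cdot)$ denotes the minimal number of generators as an $A$-module.
   Formalization: The rings are assumed nonzero: for A = B = 0 the inequality fails as printed, since id_A(0) = 1 (least n ≥ 1) while μ_A(B) = 0. *)

theory Defs
  imports "HOL-Computational_Algebra.Polynomial" "HOL-Library.Extended_Nat"
begin

text \<open>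
  Rings are unital subrings of an ambient commutative ring; taking
  \<^term>\<open>B = UNIV\<close> covers an arbitrary extension \<open>A \<subseteq> B\<close>. The class
  \<^class>\<open>comm_ring_1\<close> contains \<open>0 \<noteq> 1\<close>, so the zero ring is excluded.
\<close>

definition is_subring :: "'r::comm_ring_1 set \<Rightarrow> bool" where
  "is_subring A \<longleftrightarrow> 1 \<in> A \<and> (\<forall>x\<in>A. \<forall>y\<in>A. x - y \<in> A \<and> x * y \<in> A)"

definition ring_extension :: "'r::comm_ring_1 set \<Rightarrow> 'r set \<Rightarrow> bool" where
  "ring_extension A B \<longleftrightarrow> is_subring A \<and> is_subring B \<and> A \<subseteq> B"

definition satisfies_monic_eq :: "'r::comm_ring_1 set \<Rightarrow> nat \<Rightarrow> 'r \<Rightarrow> bool" where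
  "satisfies_monic_eq A n b \<longleftrightarrow>
     (\<exists>p. set (coeffs p) \<subseteq> A \<and> lead_coeff p = 1 \<and> degree p = n \<and> poly p b = 0)"

definition integral_elem :: "'r::comm_ring_1 set \<Rightarrow> 'r \<Rightarrow> bool" where
  "integral_elem A b \<longleftrightarrow> (\<exists>n\<ge>1. satisfies_monic_eq A n b)"

definition integral_extension :: "'r::comm_ring_1 set \<Rightarrow> 'r set \<Rightarrow> bool" where
  "integral_extension A B \<longleftrightarrow> ring_extension A B \<and> (\<forall>b\<in>B. integral_elem A b)"

text \<open>Meaningful only if \<open>b\<close> is integral over \<open>A\<close>.\<close>

definition integral_degree :: "'r::comm_ring_1 set \<Rightarrow> 'r \<Rightarrow> nat" where
  "integral_degree A b = (LEAST n. 1 \<le> n \<and> satisfies_monic_eq A n b)"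

text \<open>Meaningful only if \<open>A \<subseteq> B\<close> is integral; the supremum may be \<^term>\<open>\<infinity> :: enat\<close>.\<close>

definition extension_degree :: "'r::comm_ring_1 set \<Rightarrow> 'r set \<Rightarrow> enat" where
  "extension_degree A B = (SUP b\<in>B. enat (integral_degree A b))"

definition span_over :: "'r::comm_ring_1 set \<Rightarrow> 'r set \<Rightarrow> 'r set" where
  "span_over A S = {\<Sum>s\<in>T. c s * s | T c. finite T \<and> T \<subseteq> S \<and> c ` T \<subseteq> A}"

definition generates_over :: "'r::comm_ring_1 set \<Rightarrow> 'r set \<Rightarrow> 'r set \<Rightarrow> bool" where
  "generates_over A S M \<longleftrightarrow> S \<subseteq> M \<and> span_over A S = M"

definition finitely_generated_over :: "'r::comm_ring_1 set \<Rightarrow> 'r set \<Rightarrow> bool" where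
  "finitely_generated_over A M \<longleftrightarrow> (\<exists>S. finite S \<and> generates_over A S M)"

text \<open>Meaningful only if \<open>M\<close> is finitely generated over \<open>A\<close>.\<close>

definition min_generators :: "'r::comm_ring_1 set \<Rightarrow> 'r set \<Rightarrow> nat" where
  "min_generators A M = (LEAST n. \<exists>S. finite S \<and> card S = n \<and> generates_over A S M)"

end

theory Submission
  imports Defs "Jordan_Normal_Form.Char_Poly"
begin

text \<open>
  The determinant trick: if \<open>s\<^sub>1, \<dots>, s\<^sub>n\<close> generate \<open>B\<close> over \<open>A\<close> and \<open>b \<in> B\<close>, then
  \<open>b s\<^sub>i = \<Sum>\<^sub>j m\<^sub>i\<^sub>j s\<^sub>j\<close> with \<open>m\<^sub>i\<^sub>j \<in> A\<close>. Multiplying \<open>(b I - M) s = 0\<close> by the adjugate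
  shows that \<open>\<chi>\<^sub>M(b)\<close> annihilates every \<open>s\<^sub>i\<close>, hence \<open>B\<close>, hence \<open>1\<close>, so \<open>b\<close> is a root of
  \<open>\<chi>\<^sub>M\<close>, which is monic of degree \<open>n\<close>.
\<close>

lemma is_subring_closed:
  assumes "is_subring R"
  shows is_subring_one: "1 \<in> R"
    and is_subring_zero: "0 \<in> R"
    and is_subring_minus: "x \<in> R \<Longrightarrow> - x \<in> R"
    and is_subring_add: "x \<in> R \<Longrightarrow> y \<in> R \<Longrightarrow> x + y \<in> R"
    and is_subring_mult: "x \<in> R \<Longrightarrow> y \<in> R \<Longrightarrow> x * y \<in> R"
proof -
  have d: "\<And>x y. x \<in> R \<Longrightarrow> y \<in> R \<Longrightarrow> x - y \<in> R"
    using assms by (auto simp: is_subring_def)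
  show one: "1 \<in> R" using assms by (auto simp: is_subring_def)
  show zero: "0 \<in> R" using d[OF one one] by simp
  show minus: "- x \<in> R" if "x \<in> R" for x using d[OF zero that] by simp
  show "x + y \<in> R" if "x \<in> R" "y \<in> R" using d[OF that(1) minus[OF that(2)]] by simp
  show "x * y \<in> R" if "x \<in> R" "y \<in> R" using assms that by (auto simp: is_subring_def)
qed

lemma is_subring_sum:
  assumes "is_subring R" "\<And>i. i \<in> I \<Longrightarrow> f i \<in> R"
  shows "sum f I \<in> R"
  using assms(2)
  \<comment> \<open>For infinite \<open>I\<close> the sum is 0 by convention, which lies in
    \<open>R\<close>; likewise an infinite product below is 1.\<close>
  by (induction I rule: infinite_finite_induct)
     (auto intro: is_subring_zero[OF assms(1)] is_subring_add[OF assms(1)])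

lemma is_subring_prod:
  assumes "is_subring R" "\<And>i. i \<in> I \<Longrightarrow> f i \<in> R"
  shows "prod f I \<in> R"
  using assms(2)
  by (induction I rule: infinite_finite_induct)
     (auto intro: is_subring_one[OF assms(1)] is_subring_mult[OF assms(1)])

text \<open>By the Leibniz formula the determinant is a sum of signed products of entries. Matrices
  live over the ambient ring, so membership in the subring has to be tracked separately.\<close>

lemma is_subring_det:
  assumes R: "is_subring R" and M: "M \<in> carrier_mat n n"
    and entries: "\<And>i j. i < n \<Longrightarrow> j < n \<Longrightarrow> M $$ (i, j) \<in> R"
  shows "det M \<in> R"
proof -
  have sign: "(signof p :: 'a) \<in> R" for p
    using is_subring_one[OF R] is_subring_minus[OF R, of 1] by (auto simp: sign_def)
  show ?thesis
    unfolding det_def'[OF M]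
    by (intro is_subring_sum[OF R] is_subring_mult[OF R sign] is_subring_prod[OF R] entries)
       (auto simp: permutes_in_image)
qed

text \<open>Lets \<open>is_subring_det\<close> be applied inside the polynomial ring, where the
  characteristic polynomial is a determinant.\<close>

lemma is_subring_polys_over:
  assumes "is_subring R"
  shows "is_subring {p. \<forall>i. coeff p i \<in> R}"
  using assms
  by (auto simp: is_subring_def coeff_mult coeff_1 is_subring_zero[OF assms]
      intro!: is_subring_sum[OF assms])

lemma coeff_char_poly_in_subring:
  assumes R: "is_subring R" and M: "M \<in> carrier_mat n n"
    and entries: "\<And>i j. i < n \<Longrightarrow> j < n \<Longrightarrow> M $$ (i, j) \<in> R"
  shows "coeff (char_poly M) k \<in> R"
proof -
  \<comment> \<open>The entries of \<open>char_poly_matrix M\<close> have degree at most 1, so the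
    cases to separate are \<open>l = 0\<close>, \<open>l = 1\<close> and
    \<open>l > 1\<close>.\<close>
  have "coeff (char_poly_matrix M $$ (i, j)) l \<in> R" if "i < n" "j < n" for i j l
    using that M entries[OF that]
    by (cases l; cases "l - 1")
       (auto simp: char_poly_matrix_def is_subring_closed[OF R])
  then have "char_poly M \<in> {p. \<forall>i. coeff p i \<in> R}"
    unfolding char_poly_def
    by (intro is_subring_det[OF is_subring_polys_over[OF R] char_poly_matrix_closed[OF M]]) auto
  then show ?thesis by simp
qed

lemma smult_one_mat_mult_vec:
  fixes v :: "'a :: comm_ring_1 vec"
  assumes "v \<in> carrier_vec n"
  shows "(k \<cdot>\<^sub>m 1\<^sub>m n) *\<^sub>v v = k \<cdot>\<^sub>v v"
  using assms by (intro eq_vecI) auto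

lemma poly_char_poly_annihilates:
  fixes M :: "'a :: comm_ring_1 mat"
  assumes M: "M \<in> carrier_mat n n" and v: "v \<in> carrier_vec n"
    and eigen: "M *\<^sub>v v = b \<cdot>\<^sub>v v"
  shows "poly (char_poly M) b \<cdot>\<^sub>v v = 0\<^sub>v n"
proof -
  define N where "N = map_mat (\<lambda>p. poly p b) (char_poly_matrix M)"
  have N: "N \<in> carrier_mat n n" using M by (simp add: N_def)
  \<comment> \<open>Evaluation at \<open>b\<close> is a ring homomorphism, so it commutes with the
    determinant.\<close>
  have det: "det N = poly (char_poly M) b" by (simp only: N_def char_poly_def comm_ring_hom.hom_det[OF poly_hom.comm_ring_hom_axioms])
  have "N = b \<cdot>\<^sub>m 1\<^sub>m n - M"
    using M by (intro eq_matI) (auto simp: N_def char_poly_matrix_def)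
  then have "N *\<^sub>v v = b \<cdot>\<^sub>v v - M *\<^sub>v v"
    using M v by (simp add: minus_mult_distrib_mat_vec[of _ n n] smult_one_mat_mult_vec)
  also have "\<dots> = 0\<^sub>v n" using v by (simp add: eigen)
  finally have "adj_mat N *\<^sub>v (N *\<^sub>v v) = 0\<^sub>v n"
    using adj_mat(1)[OF N] by (auto intro!: eq_vecI)
  moreover have "adj_mat N *\<^sub>v (N *\<^sub>v v) = (adj_mat N * N) *\<^sub>v v"
    using adj_mat(1)[OF N] N v by simp
  ultimately show ?thesis
    using v by (simp add: adj_mat(3)[OF N] det smult_one_mat_mult_vec)
qed

text \<open>Padding with zero coefficients turns a combination over some
  \<open>T \<subseteq> S\<close> into one over all of \<open>S\<close>. The default 0 also keeps
  \<open>c\<close> in \<open>A\<close> outside \<open>S\<close>.\<close>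

lemma span_over_finite:
  assumes A: "is_subring A" and S: "finite S" and x: "x \<in> span_over A S"
  obtains c where "\<And>s. c s \<in> A" "x = (\<Sum>s\<in>S. c s * s)"
proof -
  obtain T c where T: "T \<subseteq> S" "c ` T \<subseteq> A" "x = (\<Sum>s\<in>T. c s * s)"
    using x unfolding span_over_def by blast
  let ?c = "\<lambda>s. if s \<in> T then c s else 0"
  have "(\<Sum>s\<in>S. ?c s * s) = x"
    unfolding T(3) using S T(1) by (intro sum.mono_neutral_cong_right) auto
  with T(2) show ?thesis
    by (intro that[of ?c]) (auto simp: is_subring_zero[OF A])
qed

lemma satisfies_monic_eq_card_generators:
  assumes ext: "ring_extension A B" and S: "finite S" and gen: "generates_over A S B"
    and b: "b \<in> B"
  shows "satisfies_monic_eq A (card S) b"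
proof -
  have A: "is_subring A" and B: "is_subring B"
    using ext by (auto simp: ring_extension_def)
  have SB: "S \<subseteq> B" and span: "span_over A S = B"
    using gen by (auto simp: generates_over_def)
  define n where "n = card S"
  \<comment> \<open>Matrix indices are numbers, so the generators are enumerated: entry
    \<open>(i, j)\<close> of \<open>M\<close> will be the coefficient of \<open>h j\<close> in
    \<open>b * h i\<close>.\<close>
  obtain h where h: "bij_betw h {0..<n} S"
    using ex_bij_betw_nat_finite[OF S] unfolding n_def by blast
  have hS: "h i \<in> S" if "i < n" for i using h that by (auto simp: bij_betw_def)
  have "\<forall>t\<in>S. \<exists>c. (\<forall>s. c s \<in> A) \<and> b * t = (\<Sum>s\<in>S. c s * s)"
  proof
    fix t assume "t \<in> S"
    then have "b * t \<in> span_over A S"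
      using is_subring_mult[OF B b] SB span by auto
    then show "\<exists>c. (\<forall>s. c s \<in> A) \<and> b * t = (\<Sum>s\<in>S. c s * s)"
      by (rule span_over_finite[OF A S]) auto
  qed
  then obtain c where "\<forall>t\<in>S. (\<forall>s. c t s \<in> A) \<and> b * t = (\<Sum>s\<in>S. c t s * s)"
    unfolding bchoice_iff by blast
  then have cA: "c t s \<in> A" and c: "b * t = (\<Sum>s\<in>S. c t s * s)" if "t \<in> S" for t s
    using that by blast+
  define M where "M = mat n n (\<lambda>(i, j). c (h i) (h j))"
  define v where "v = vec n h"
  have M: "M \<in> carrier_mat n n" and v: "v \<in> carrier_vec n" by (simp_all add: M_def v_def)
  have "M *\<^sub>v v = b \<cdot>\<^sub>v v"
  proof (rule eq_vecI)
    fix i assume "i < dim_vec (b \<cdot>\<^sub>v v)"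
    then have i: "i < n" by (simp add: v_def)
    have "(M *\<^sub>v v) $ i = (\<Sum>j\<in>{0..<n}. c (h i) (h j) * h j)"
      using i by (simp add: M_def v_def scalar_prod_def)
    also have "\<dots> = b * h i"
      unfolding c[OF hS[OF i]] by (rule sum.reindex_bij_betw[OF h])
    finally show "(M *\<^sub>v v) $ i = (b \<cdot>\<^sub>v v) $ i" using i by (simp add: v_def)
  qed (simp add: M_def v_def)
  then have vanish: "poly (char_poly M) b \<cdot>\<^sub>v v = 0\<^sub>v n"
    by (rule poly_char_poly_annihilates[OF M v])
  have kill: "poly (char_poly M) b * s = 0" if s: "s \<in> S" for s
  proof -
    obtain i where i: "i < n" "s = h i" using s h by (auto simp: bij_betw_def)
    have "(poly (char_poly M) b \<cdot>\<^sub>v v) $ i = 0" using i(1) by (simp add: vanish)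
    then show ?thesis using i by (simp add: v_def)
  qed
  \<comment> \<open>Since 1 is itself a combination of generators, a scalar that kills every
    generator is 0.\<close>
  have "1 \<in> span_over A S" using is_subring_one[OF B] span by simp
  then obtain e where e: "1 = (\<Sum>s\<in>S. e s * s)"
    by (rule span_over_finite[OF A S])
  have "poly (char_poly M) b = poly (char_poly M) b * (\<Sum>s\<in>S. e s * s)"
    by (simp only: e[symmetric] mult_1_right)
  also have "\<dots> = (\<Sum>s\<in>S. e s * (poly (char_poly M) b * s))"
    by (simp add: sum_distrib_left mult.left_commute)
  also have "\<dots> = 0" by (simp add: kill)
  finally have root: "poly (char_poly M) b = 0" .
  have "coeff (char_poly M) k \<in> A" for k
    by (rule coeff_char_poly_in_subring[OF A M]) (simp add: M_def cA hS)
  then have "set (coeffs (char_poly M)) \<subseteq> A"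
    by (auto simp: coeffs_def)
  with degree_monic_char_poly[OF M] root show ?thesis
    unfolding satisfies_monic_eq_def n_def[symmetric]
    by (intro exI[of _ "char_poly M"]) simp
qed

text \<open>The empty set spans only 0, whereas \<open>B\<close> contains 1 and the class
  \<open>comm_ring_1\<close> gives \<open>0 \<noteq> 1\<close>. This meets the condition
  \<open>1 \<le> n\<close> in \<open>integral_elem\<close> and
  \<open>integral_degree\<close>.\<close>

lemma card_generators_ge_1:
  assumes "ring_extension A B" "finite S" "generates_over A S B"
  shows "1 \<le> card S"
proof -
  have "1 \<in> span_over A S"
    using assms is_subring_one by (auto simp: ring_extension_def generates_over_def)
  then have "S \<noteq> {}" by (auto simp: span_over_def)
  with assms(2) show ?thesis by (simp add: Suc_le_eq card_gt_0_iff)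
qed

theorem corollary6p3:
  fixes A B :: "'r::comm_ring_1 set"
  assumes "ring_extension A B"
    and "finitely_generated_over A B"
  shows "integral_extension A B \<and> extension_degree A B \<le> enat (min_generators A B)"
proof -
  have "\<exists>n S. finite S \<and> card S = n \<and> generates_over A S B"
    using assms(2) by (auto simp: finitely_generated_over_def)
  then have "\<exists>S. finite S \<and> card S = min_generators A B \<and> generates_over A S B"
    unfolding min_generators_def by (rule LeastI_ex)
  then obtain S where S: "finite S" "card S = min_generators A B" "generates_over A S B"
    by blast
  \<comment> \<open>A generating set of least size gives one degree that serves every
    \<open>b\<close>: as a witness it shows integrality, and as a candidate for \<open>LEAST\<close>
    it bounds each integral degree.\<close>
  have monic: "1 \<le> min_generators A B \<and> satisfies_monic_eq A (min_generators A B) b"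
    if "b \<in> B" for b
    using satisfies_monic_eq_card_generators[OF assms(1) S(1,3) that]
      card_generators_ge_1[OF assms(1) S(1,3)] S(2) by simp
  have "integral_extension A B"
    using assms(1) monic unfolding integral_extension_def integral_elem_def by blast
  moreover have "integral_degree A b \<le> min_generators A B" if "b \<in> B" for b
    unfolding integral_degree_def by (rule Least_le) (rule monic[OF that])
  then have "extension_degree A B \<le> enat (min_generators A B)"
    unfolding extension_degree_def by (intro SUP_least) simp
  ultimately show ?thesis by blast
qed

end
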